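(* For any rational number $t > 1/2$, there exists no minimally $t$-tough, strongly chordal graph.
   Context: All graphs are finite, simple and undirected. $\omega(H)$ denotes the number of connected components of a graph $H$. For a real number $t$, a graph $G$ is $t$-tough if $|S| \ge t\cdot\omega(G-S)$ for every $S \subseteq V(G)$ with $\omega(G-S) > 1$. The toughness $\tau(G)$ is the largest $t$ for which $G$ is $t$-tough, where $\tau(K_n)=\infty$ for all $n\ge 1$. A graph $G$ is minimally $t$-tough if $\tau(G)=t$ and $\tau(G-e)<t$ for every $e\in E(G)$. A graph is chordal if it contains no induced cycle of length at least $4$. A graph is strongly chordal if it is chordal and every even cycle of length at least $6$ has an odd chord, i.e., a chord whose endpoints are an odd distance apart in the cycle. *)

theory Defs
  imports Complex_Main "HOL-Library.Extended_Real"
begin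

text \<open>A graph is given by its vertex set \<open>V\<close> and its edge set \<open>E\<close>, whose members are
  two-element subsets of \<open>V\<close>.\<close>

definition simple_graph :: "'a set \<Rightarrow> 'a set set \<Rightarrow> bool" where
  "simple_graph V E \<longleftrightarrow> finite V \<and> E \<subseteq> {{u, v} | u v. u \<in> V \<and> v \<in> V \<and> u \<noteq> v}"

definition complete_graph :: "'a set \<Rightarrow> 'a set set \<Rightarrow> bool" where
  "complete_graph V E \<longleftrightarrow> E = {{u, v} | u v. u \<in> V \<and> v \<in> V \<and> u \<noteq> v}"

definition induced_edges :: "'a set set \<Rightarrow> 'a set \<Rightarrow> 'a set set" where
  "induced_edges E W = {e \<in> E. e \<subseteq> W}"

definition connected_in :: "'a set \<Rightarrow> 'a set set \<Rightarrow> 'a rel" where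
  "connected_in V E = {(u, v). u \<in> V \<and> v \<in> V \<and> (u, v) \<in> {(x, y). {x, y} \<in> E}\<^sup>*}"

definition num_components :: "'a set \<Rightarrow> 'a set set \<Rightarrow> nat" where
  "num_components V E = card (V // connected_in V E)"

definition tough :: "real \<Rightarrow> 'a set \<Rightarrow> 'a set set \<Rightarrow> bool" where
  "tough t V E \<longleftrightarrow>
     (\<forall>S \<subseteq> V. num_components (V - S) (induced_edges E (V - S)) > 1 \<longrightarrow>
        real (card S) \<ge> t * real (num_components (V - S) (induced_edges E (V - S))))"

text \<open>The greatest element exists for every non-complete simple graph; see
  \<open>tough_iff_le_toughness\<close> below.\<close>

definition toughness :: "'a set \<Rightarrow> 'a set set \<Rightarrow> ereal" where
  "toughness V E = (if complete_graph V E then \<infinity> else ereal (GREATEST t. tough t V E))"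

definition minimally_tough :: "real \<Rightarrow> 'a set \<Rightarrow> 'a set set \<Rightarrow> bool" where
  "minimally_tough t V E \<longleftrightarrow>
     toughness V E = ereal t \<and> (\<forall>e \<in> E. toughness V (E - {e}) < ereal t)"

text \<open>A cycle is represented by the list of its vertices in cyclic order; positions are
  taken modulo the length of the list.\<close>

definition cycle_edges :: "'a list \<Rightarrow> 'a set set" where
  "cycle_edges c = {{c ! i, c ! (Suc i mod length c)} | i. i < length c}"

definition is_cycle :: "'a set \<Rightarrow> 'a set set \<Rightarrow> 'a list \<Rightarrow> bool" where
  "is_cycle V E c \<longleftrightarrow>
     length c \<ge> 3 \<and> distinct c \<and> set c \<subseteq> V \<and> cycle_edges c \<subseteq> E"

definition chordal :: "'a set \<Rightarrow> 'a set set \<Rightarrow> bool" where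
  "chordal V E \<longleftrightarrow>
     \<not> (\<exists>c. is_cycle V E c \<and> length c \<ge> 4 \<and> induced_edges E (set c) = cycle_edges c)"

definition cycle_dist :: "'a list \<Rightarrow> nat \<Rightarrow> nat \<Rightarrow> nat" where
  "cycle_dist c i j = (let d = max i j - min i j in min d (length c - d))"

definition has_odd_chord :: "'a set set \<Rightarrow> 'a list \<Rightarrow> bool" where
  "has_odd_chord E c \<longleftrightarrow>
     (\<exists>i j. i < length c \<and> j < length c \<and> {c ! i, c ! j} \<in> E - cycle_edges c \<and>
        odd (cycle_dist c i j))"

definition strongly_chordal :: "'a set \<Rightarrow> 'a set set \<Rightarrow> bool" where
  "strongly_chordal V E \<longleftrightarrow> chordal V E \<and>
     (\<forall>c. is_cycle V E c \<and> even (length c) \<and> length c \<ge> 6 \<longrightarrow> has_odd_chord E c)"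

lemma tough_greatest_exists:
  assumes "simple_graph V E" "\<not> complete_graph V E"
  shows "\<exists>t. tough t V E \<and> (\<forall>s. tough s V E \<longrightarrow> s \<le> t)"
proof -
  define w where "w S = num_components (V - S) (induced_edges E (V - S))" for S
  define F where "F = {S. S \<subseteq> V \<and> w S > 1}"
  define f where "f S = real (card S) / real (w S)" for S
  have fin: "finite F" using assms(1) by (auto simp: F_def simple_graph_def)
  obtain u v where uv: "u \<in> V" "v \<in> V" "u \<noteq> v" "{u, v} \<notin> E"
    using assms by (auto simp: simple_graph_def complete_graph_def)
  have VS: "V - (V - {u, v}) = {u, v}" using uv by auto
  have "induced_edges E {u, v} = {}"
  proof (rule ccontr)
    assume "induced_edges E {u, v} \<noteq> {}"
    then obtain e where e: "e \<in> E" "e \<subseteq> {u, v}" by (auto simp: induced_edges_def)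
    then obtain x y where "e = {x, y}" "x \<noteq> y"
      using assms(1) by (auto simp: simple_graph_def)
    with e(2) have "e = {u, v}" by auto
    with e(1) uv(4) show False by simp
  qed
  moreover have "connected_in {u, v} {} = {(u, u), (v, v)}"
    by (auto simp: connected_in_def)
  ultimately have "w (V - {u, v}) = card ({u, v} // {(u, u), (v, v)})"
    by (simp add: w_def VS num_components_def)
  also have "{u, v} // {(u, u), (v, v)} = {{u}, {v}}"
    using uv(3) by (auto simp: quotient_def)
  finally have "V - {u, v} \<in> F" using uv(3) by (auto simp: F_def)
  then have ne: "F \<noteq> {}" by auto
  have tough_iff: "tough s V E \<longleftrightarrow> (\<forall>S\<in>F. s \<le> f S)" for s
    by (auto simp: tough_def F_def f_def w_def field_simps)
  have "tough s V E \<longleftrightarrow> s \<le> Min (f ` F)" for s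
    unfolding tough_iff using fin ne by (subst Min_ge_iff) auto
  then show ?thesis by blast
qed

lemma tough_iff_le_toughness:
  assumes "simple_graph V E"
  shows "tough t V E \<longleftrightarrow> ereal t \<le> toughness V E"
proof (cases "complete_graph V E")
  case True
  have "num_components W (induced_edges E W) \<le> 1" if "W \<subseteq> V" for W
  proof -
    have fin: "finite W" using assms that finite_subset by (auto simp: simple_graph_def)
    have "(x, y) \<in> {(x, y). {x, y} \<in> induced_edges E W}\<^sup>*" if "x \<in> W" "y \<in> W" for x y
    proof (cases "x = y")
      case False
      with True that \<open>W \<subseteq> V\<close> have "{x, y} \<in> induced_edges E W"
        unfolding complete_graph_def induced_edges_def by blast
      then show ?thesis by auto
    qed auto
    then have "connected_in W (induced_edges E W) = W \<times> W"
      by (auto simp: connected_in_def)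
    then have "W // connected_in W (induced_edges E W) \<subseteq> {W}"
      by (auto simp: quotient_def)
    then show ?thesis unfolding num_components_def
      using card_mono[of "{W}"] by fastforce
  qed
  then have "tough t V E" unfolding tough_def by (metis Diff_subset not_less)
  with True show ?thesis by (simp add: toughness_def)
next
  case False
  obtain m where m: "tough m V E" "\<And>s. tough s V E \<Longrightarrow> s \<le> m"
    using tough_greatest_exists[OF assms False] by blast
  then have "(GREATEST t. tough t V E) = m" by (intro Greatest_equality) auto
  moreover have "tough s V E" if "s \<le> m" for s
    using m(1) that unfolding tough_def
    by (meson mult_right_mono of_nat_0_le_iff order_trans)
  ultimately show ?thesis using m(2) False by (auto simp: toughness_def)
qed

end

theory Submission
  imports Defs
begin

text \<open>A strongly chordal graph has a vertex \<open>v\<close> the closed neighbourhoods of whose neighbours form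
  a chain. Let \<open>a\<close> and \<open>b\<close> be neighbours of \<open>v\<close> with the smallest and the largest closed
  neighbourhood, and let \<open>S\<close> witness that deleting the edge \<open>ab\<close> lowers the toughness. Then \<open>a\<close>
  and \<open>b\<close> lie in different components of \<open>G - ab - S\<close>, so all neighbours of \<open>a\<close> other than
  \<open>b\<close> lie in \<open>S\<close>. If \<open>b\<close> has another neighbour outside \<open>S\<close>, exchanging \<open>v\<close> for \<open>b\<close> in \<open>S\<close>
  loses no component. Otherwise removing from \<open>S\<close> all neighbours of \<open>v\<close> and \<open>v\<close> itself saves
  \<open>deg v - 1\<close> vertices, which is at least \<open>t\<close> because \<open>deg v\<close> is at least \<open>2 * t > 1\<close>, and costs
  one component. Either way \<open>G\<close> is not \<open>t\<close>-tough.\<close>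

section \<open>Doubly lexical orderings\<close>

lemma sum_indicator_diff_mult:
  fixes F :: "'a \<Rightarrow> int"
  assumes "finite V" "a \<in> V" "b \<in> V"
  shows "(\<Sum>x\<in>V. (of_bool (x = a) - of_bool (x = b)) * F x) = F a - F b"
proof -
  have "(\<Sum>x\<in>V. of_bool (x = c) * F x) = F c" if "c \<in> V" for c
  proof -
    have "(\<Sum>x\<in>V. of_bool (x = c) * F x) = (\<Sum>x\<in>V. if x = c then F x else 0)"
      by (intro sum.cong) auto
    then show ?thesis using assms(1) that by simp
  qed
  then show ?thesis using assms by (simp add: left_diff_distrib sum_subtractf)
qed

text \<open>Distinct exponents below \<open>k\<close> are the positions of the ones in a binary
  number with at most \<open>k\<close> digits.\<close>

lemma sum_pow2_less:
  assumes "finite A" "inj_on s A" "\<And>x. x \<in> A \<Longrightarrow> s x < k"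
  shows "(\<Sum>x\<in>A. 2 ^ s x) < (2 ^ k :: int)"
proof -
  have "(\<Sum>x\<in>A. 2 ^ s x) = (\<Sum>i\<in>s ` A. 2 ^ i :: int)"
    using assms(2) by (simp add: sum.reindex)
  also have "\<dots> \<le> (\<Sum>i<k. 2 ^ i)"
    using assms by (intro sum_mono2) auto
  also have "\<dots> < 2 ^ k"
    by (induction k) auto
  finally show ?thesis .
qed

text \<open>A doubly lexical ordering of a symmetric 0/1 matrix with ones on the diagonal, one order
  serving rows and columns: read from the last column backwards, later rows are lexicographically at
  least as large. Assumption \<open>lex\<close> expresses this without naming the last column where
  two rows differ.\<close>

locale lexically_ordered =
  fixes V :: "'a set" and n :: "'a \<Rightarrow> 'a \<Rightarrow> bool" and s :: "'a \<Rightarrow> nat"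
  assumes finite_V: "finite V"
    and refl_n: "n x x"
    and sym_n: "n x y \<Longrightarrow> n y x"
    and inj_s: "inj_on s V"
    and lex: "\<lbrakk>a \<in> V; b \<in> V; s a < s b; c \<in> V; n a c; \<not> n b c\<rbrakk>
      \<Longrightarrow> \<exists>d\<in>V. s c < s d \<and> n b d \<and> \<not> n a d"

text \<open>The ordering maximises the quadratic form of the relation at the vector \<open>2 ^ s x\<close>.
  Exchanging the positions of \<open>a\<close> and \<open>b\<close> then compares the binary numbers whose digits are
  the rows of \<open>a\<close> and \<open>b\<close>.\<close>

lemma lexically_ordered_exists:
  fixes V :: "'a set" and n :: "'a \<Rightarrow> 'a \<Rightarrow> bool"
  assumes fin: "finite V" and rfl: "\<And>x. n x x" and sym: "\<And>x y. n x y \<Longrightarrow> n y x"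
  shows "\<exists>s. lexically_ordered V n s"
proof -
  define m :: "'a \<Rightarrow> 'a \<Rightarrow> int" where "m x y = of_bool (n x y)" for x y
  define Q where "Q w = (\<Sum>x\<in>V. \<Sum>y\<in>V. m x y * (w x * w y))" for w :: "'a \<Rightarrow> int"
  define P where "P s \<longleftrightarrow> bij_betw s V {..<card V}" for s :: "'a \<Rightarrow> nat"
  define pw :: "('a \<Rightarrow> nat) \<Rightarrow> 'a \<Rightarrow> int" where "pw s x = 2 ^ s x" for s x
  have m_sym: "m x y = m y x" for x y
    using sym by (auto simp: m_def)
  obtain s0 where "P s0"
    using fin finite_same_card_bij[of V "{..<card V}"] by (auto simp: P_def)
  \<comment> \<open>Boundedness makes a maximal ordering exist; \<open>nat\<close> adapts the
    integer form to the maximum principle for naturals.\<close>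
  moreover have "nat (Q (pw s)) < Suc (nat (\<Sum>x\<in>V. \<Sum>y\<in>V. 2 ^ card V * 2 ^ card V))"
    if "P s" for s
  proof -
    have "pw s x \<le> 2 ^ card V" if "x \<in> V" for x
      using that \<open>P s\<close> unfolding pw_def
      by (intro power_increasing) (auto simp: P_def dest!: bij_betwE)
    then have "m x y * (pw s x * pw s y) \<le> 2 ^ card V * 2 ^ card V" if "x \<in> V" "y \<in> V" for x y
      using that mult_mono[of "pw s x" "2 ^ card V" "pw s y" "2 ^ card V"]
      by (auto simp: m_def pw_def)
    then have "Q (pw s) \<le> (\<Sum>x\<in>V. \<Sum>y\<in>V. 2 ^ card V * 2 ^ card V)"
      unfolding Q_def by (intro sum_mono) auto
    then show ?thesis by linarith
  qed
  ultimately obtain s where s: "P s" "\<And>s'. P s' \<Longrightarrow> nat (Q (pw s')) \<le> nat (Q (pw s))"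
    using ex_has_greatest_nat[of P s0 "\<lambda>s. nat (Q (pw s))"] by blast
  have Q_nonneg: "Q (pw s') \<ge> 0" for s'
    unfolding Q_def by (intro sum_nonneg) (auto simp: m_def pw_def)
  have max: "Q (pw s') \<le> Q (pw s)" if "P s'" for s'
    using s(2)[OF that] Q_nonneg[of s'] Q_nonneg[of s] by linarith
  have inj: "inj_on s V"
    using s(1) by (auto simp: P_def bij_betw_def)
  have row: "(\<Sum>y\<in>V. m a y * pw s y) \<le> (\<Sum>y\<in>V. m b y * pw s y)"
    if ab: "a \<in> V" "b \<in> V" "s a < s b" for a b
  proof -
    define h :: "'a \<Rightarrow> int" where "h x = of_bool (x = a) - of_bool (x = b)" for x
    define d where "d = pw s b - pw s a"
    have d: "d > 0" using ab by (simp add: d_def pw_def)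
    define s' where "s' = s(a := s b, b := s a)"
    have "P s'"
      using s(1) ab unfolding P_def s'_def
      by (auto simp: bij_betw_def inj_on_def image_def)
    \<comment> \<open>Exchanging the positions of \<open>a\<close> and \<open>b\<close> moves the
      weight vector by \<open>d\<close> times a difference of unit vectors, so the form changes by a
      linear term, twice by symmetry, and a quadratic term.\<close>
    have pw': "pw s' x = pw s x + d * h x" for x
      using ab by (auto simp: pw_def s'_def d_def h_def)
    have "Q (pw s') = (\<Sum>x\<in>V. \<Sum>y\<in>V. m x y * (pw s x * pw s y) + d * (h x * (m x y * pw s y))
        + d * (h y * (m x y * pw s x)) + d * d * (h x * (h y * m x y)))"
      unfolding Q_def pw' by (intro sum.cong[OF refl]) (simp add: algebra_simps)
    also have "\<dots> = Q (pw s) + d * (\<Sum>x\<in>V. h x * (\<Sum>y\<in>V. m x y * pw s y))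
        + d * (\<Sum>x\<in>V. \<Sum>y\<in>V. h y * (m x y * pw s x))
        + d * d * (\<Sum>x\<in>V. h x * (\<Sum>y\<in>V. h y * m x y))"
      by (simp add: Q_def sum.distrib sum_distrib_left)
    also have "(\<Sum>x\<in>V. \<Sum>y\<in>V. h y * (m x y * pw s x)) = (\<Sum>x\<in>V. h x * (\<Sum>y\<in>V. m x y * pw s y))"
      by (subst sum.swap) (simp add: sum_distrib_left m_sym)
    also have "(\<Sum>x\<in>V. h x * (\<Sum>y\<in>V. m x y * pw s y))
        = (\<Sum>y\<in>V. m a y * pw s y) - (\<Sum>y\<in>V. m b y * pw s y)"
      unfolding h_def using fin ab(1,2) by (rule sum_indicator_diff_mult)
    also have "(\<Sum>x\<in>V. h x * (\<Sum>y\<in>V. h y * m x y)) = (m a a - m a b) - (m b a - m b b)"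
      unfolding h_def using fin ab(1,2) by (simp only: sum_indicator_diff_mult)
    also have "\<dots> = 2 * (1 - m a b)"
      using rfl by (simp add: m_sym[of b a]) (simp add: m_def)
    finally have "Q (pw s') - Q (pw s) =
        2 * d * ((\<Sum>y\<in>V. m a y * pw s y) - (\<Sum>y\<in>V. m b y * pw s y) + d * (1 - m a b))"
      by (simp add: algebra_simps)
    with max[OF \<open>P s'\<close>] d
    have "(\<Sum>y\<in>V. m a y * pw s y) - (\<Sum>y\<in>V. m b y * pw s y) + d * (1 - m a b) \<le> 0"
      by (smt (verit) mult_pos_pos)
    moreover have "d * (1 - m a b) \<ge> 0" using d by (simp add: m_def)
    ultimately show ?thesis by linarith
  qed
  have "lexically_ordered V n s"
  proof
    fix a b c
    assume ab: "a \<in> V" "b \<in> V" "s a < s b" and c: "c \<in> V" "n a c" "\<not> n b c"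
    define A where "A = {y \<in> V. n a y \<and> \<not> n b y}"
    define B where "B = {y \<in> V. n b y \<and> \<not> n a y}"
    define C where "C = {y \<in> V. n a y \<and> n b y}"
    have fins: "finite A" "finite B" "finite C" using fin by (auto simp: A_def B_def C_def)
    have sum_m: "(\<Sum>y\<in>V. m z y * pw s y) = (\<Sum>y\<in>{y \<in> V. n z y}. pw s y)" for z
    proof -
      have "(\<Sum>y\<in>V. m z y * pw s y) = (\<Sum>y\<in>V. if n z y then pw s y else 0)"
        by (intro sum.cong) (auto simp: m_def)
      then show ?thesis using fin by (simp add: sum.inter_filter)
    qed
    have "{y \<in> V. n a y} = A \<union> C" "{y \<in> V. n b y} = B \<union> C" "A \<inter> C = {}" "B \<inter> C = {}"
      by (auto simp: A_def B_def C_def)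
    then have le: "sum (pw s) A \<le> sum (pw s) B"
      using row[OF ab] fins by (simp add: sum_m sum.union_disjoint)
    show "\<exists>d\<in>V. s c < s d \<and> n b d \<and> \<not> n a d"
    proof (rule ccontr)
      assume no: "\<not> ?thesis"
      \<comment> \<open>Without such a column all of \<open>B\<close> would lie before
        \<open>c\<close>, and \<open>c\<close> in \<open>A\<close> alone would outweigh
        \<open>B\<close>.\<close>
      have "s y < s c" if "y \<in> B" for y
      proof -
        have "y \<noteq> c" "y \<in> V" using that c by (auto simp: B_def)
        then have "s y \<noteq> s c" using inj c by (auto dest: inj_onD)
        moreover have "\<not> s c < s y" using no that by (auto simp: B_def)
        ultimately show ?thesis by simp
      qed
      then have "sum (pw s) B < 2 ^ s c"
        unfolding pw_def using fins inj
        by (intro sum_pow2_less) (auto simp: B_def intro: inj_on_subset)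
      also have "\<dots> \<le> sum (pw s) A"
        using member_le_sum[of c A "pw s"] c fins by (auto simp: pw_def A_def)
      finally show False using le by simp
    qed
  qed (use fin rfl sym inj in auto)
  then show ?thesis by blast
qed

section \<open>Least vertices of doubly lexical orderings\<close>

text \<open>An induced cycle of the bipartite incidence graph of rows and columns of \<open>n\<close>: even positions
  are rows and odd ones are columns, so the same vertex may occur once in each role.\<close>

definition bip_cycle :: "'a set \<Rightarrow> ('a \<Rightarrow> 'a \<Rightarrow> bool) \<Rightarrow> nat \<Rightarrow> (nat \<Rightarrow> 'a) \<Rightarrow> bool" where
  "bip_cycle V n L g \<longleftrightarrow> even L \<and> L \<ge> 6 \<and> (\<forall>i<L. g i \<in> V) \<and>
     (\<forall>i<L. \<forall>j<L. even i = even j \<and> i \<noteq> j \<longrightarrow> g i \<noteq> g j) \<and>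
     (\<forall>i<L. \<forall>j<L. even i \<noteq> even j \<longrightarrow>
        (n (g i) (g j) \<longleftrightarrow> j = Suc i mod L \<or> i = Suc j mod L))"

context lexically_ordered
begin

text \<open>A least vertex that is not simple yields rows \<open>r 1, r 2\<close> and columns \<open>c 1, c 2\<close> with
  exactly one zero, at \<open>r 2, c 2\<close>. The lexicographic property turns it into a new column \<open>c 3\<close> and
  a new row \<open>r 3\<close>, each chosen as the last place where its two predecessors differ, so that all
  earlier rows, respectively columns, vanish there. Either \<open>r 3, c 3\<close> closes an induced cycle or
  it is the next zero, and the process cannot go on forever.\<close>

definition half_ladder :: "nat \<Rightarrow> (nat \<Rightarrow> 'a) \<Rightarrow> (nat \<Rightarrow> 'a) \<Rightarrow> bool" where
  "half_ladder k r c \<longleftrightarrow> (\<forall>i. 1 \<le> i \<and> i \<le> k \<longrightarrow> c i \<in> V) \<and>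
     (\<forall>i. 1 \<le> i \<and> i < k \<longrightarrow> s (c i) < s (c (Suc i))) \<and>
     (\<forall>i y. 2 \<le> i \<and> i < k \<and> y \<in> V \<and> s (c (Suc i)) < s y \<longrightarrow> n (r (i - 1)) y = n (r i) y)"

text \<open>The ones form the induced path \<open>..., r 3, c 2, r 1, c 1, r 2, c 3, ...\<close> of
  the incidence graph.\<close>

definition ladder :: "nat \<Rightarrow> (nat \<Rightarrow> 'a) \<Rightarrow> (nat \<Rightarrow> 'a) \<Rightarrow> bool" where
  "ladder k r c \<longleftrightarrow> half_ladder k r c \<and> half_ladder k c r \<and>
     (\<forall>i j. 1 \<le> i \<and> i \<le> k \<and> 1 \<le> j \<and> j \<le> k \<longrightarrow>
        (n (r i) (c j) \<longleftrightarrow> i = Suc j \<or> j = Suc i \<or> i = 1 \<and> j = 1))"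

section \<open>Extending ladders\<close>

lemma n_commute: "n x y = n y x"
  by (rule iffI; erule sym_n)

lemma half_ladder_mono:
  assumes "half_ladder k r c" "1 \<le> i" "i < j" "j \<le> k"
  shows "s (c i) < s (c j)"
  using assms(3,4)
proof (induction j)
  case (Suc j)
  have "s (c j) < s (c (Suc j))" if "1 \<le> j"
    using assms(1) Suc.prems that by (auto simp: half_ladder_def)
  with Suc assms(2) show ?case
    by (cases "i = j") force+
qed auto

text \<open>Rows and columns play equal roles, so a construction of the next column also yields the
  next row.\<close>

lemma ladder_commute:
  assumes "ladder k r c"
  shows "ladder k c r"
  unfolding ladder_def
proof (intro conjI allI impI)
  fix i j assume "1 \<le> i \<and> i \<le> k \<and> 1 \<le> j \<and> j \<le> k"
  then have "n (r j) (c i) \<longleftrightarrow> j = Suc i \<or> i = Suc j \<or> j = 1 \<and> i = 1"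
    using assms unfolding ladder_def by blast
  then show "n (c i) (r j) \<longleftrightarrow> i = Suc j \<or> j = Suc i \<or> i = 1 \<and> j = 1"
    unfolding n_commute[of "c i"] by blast
qed (use assms in \<open>auto simp: ladder_def\<close>)

text \<open>At \<open>c k\<close> the earlier row \<open>r (k - 1)\<close> has a one and
  \<open>r k\<close> a zero, so by \<open>lex\<close> the last column where they differ favours
  \<open>r k\<close> and lies beyond \<open>c k\<close>.\<close>

lemma ladder_extend_half:
  assumes "ladder k r c" "k \<ge> 2"
  shows "\<exists>y\<in>V. s (c k) < s y \<and> n (r k) y \<and> (\<forall>i. 1 \<le> i \<and> i < k \<longrightarrow> \<not> n (r i) y) \<and>
    (\<forall>z\<in>V. s y < s z \<longrightarrow> n (r (k - 1)) z = n (r k) z)"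
proof -
  have hl: "half_ladder k r c" "half_ladder k c r" using assms by (auto simp: ladder_def)
  have rk: "r (k - 1) \<in> V" "r k \<in> V" "s (r (k - 1)) < s (r k)" "c k \<in> V"
    using hl assms(2) half_ladder_mono[OF hl(2), of "k - 1" k] by (auto simp: half_ladder_def)
  have ck: "n (r (k - 1)) (c k)" "\<not> n (r k) (c k)"
    using assms by (auto simp: ladder_def)
  define D where "D = {y \<in> V. n (r (k - 1)) y \<noteq> n (r k) y}"
  have "finite D" "c k \<in> D" using finite_V rk ck by (auto simp: D_def)
  then obtain y where y: "y \<in> D" "\<And>z. z \<in> D \<Longrightarrow> s z \<le> s y"
    using Max_in[of "s ` D"] Max_ge[of "s ` D"] by (metis empty_iff finite_imageI image_iff)
  have yr: "n (r k) y \<and> \<not> n (r (k - 1)) y"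
  proof (rule ccontr)
    assume "\<not> ?thesis"
    then have "n (r (k - 1)) y" "\<not> n (r k) y" "y \<in> V" using y(1) by (auto simp: D_def)
    then obtain d where "d \<in> V" "s y < s d" "n (r k) d" "\<not> n (r (k - 1)) d"
      using lex rk by blast
    then show False using y(2)[of d] by (auto simp: D_def)
  qed
  have "y \<noteq> c k" using yr ck by auto
  then have "s y \<noteq> s (c k)" using inj_s rk(4) y(1) by (auto simp: D_def dest: inj_onD)
  then have sy: "s (c k) < s y" using y(2)[OF \<open>c k \<in> D\<close>] by simp
  \<comment> \<open>Descent from row \<open>k - 1\<close>: the rows \<open>r (i - 1)\<close> and
    \<open>r i\<close> agree beyond \<open>c (i + 1)\<close>, which does not come after
    \<open>c k\<close>, so the zero at \<open>y\<close> passes from one to the other.\<close>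
  have low: "1 \<le> k - 1 - l \<longrightarrow> \<not> n (r (k - 1 - l)) y" for l
  proof (induction l)
    case 0 then show ?case using yr by simp
  next
    case (Suc l)
    show ?case
    proof
      assume l: "1 \<le> k - 1 - Suc l"
      define i where "i = k - 1 - l"
      have i: "2 \<le> i" "i < k" "i - 1 = k - 1 - Suc l" using l by (auto simp: i_def)
      have "s (c (Suc i)) \<le> s (c k)"
        using half_ladder_mono[OF hl(1), of "Suc i" k] i by (cases "Suc i = k") auto
      then have "n (r (i - 1)) y = n (r i) y"
        using hl(1)[unfolded half_ladder_def] i(1,2) sy y(1) unfolding D_def
        by (metis (no_types, lifting) le_less_trans mem_Collect_eq)
      then show "\<not> n (r (k - 1 - Suc l)) y" using Suc l i by (auto simp: i_def)
    qed
  qed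
  have "\<not> n (r i) y" if "1 \<le> i" "i < k" for i
    using low[of "k - 1 - i"] that by simp
  moreover have "n (r (k - 1)) z = n (r k) z" if "z \<in> V" "s y < s z" for z
    using that y(2)[of z] by (force simp: D_def)
  ultimately show ?thesis using yr sy y(1) by (auto simp: D_def)
qed

text \<open>The two sides of the ladder are read as one cycle \<open>\<dots>, c 2, r 1, c 1, r 2, \<dots>\<close>, in which
  position \<open>i\<close> carries the index \<open>k - i\<close> in the first half and \<open>i - k + 1\<close> in the second.\<close>

lemma bip_cycle_of_closed_ladder:
  assumes k: "k \<ge> 3"
    and V: "\<And>i. 1 \<le> i \<Longrightarrow> i \<le> k \<Longrightarrow> r i \<in> V \<and> c i \<in> V"
    and inj: "\<And>i j. 1 \<le> i \<Longrightarrow> i < j \<Longrightarrow> j \<le> k \<Longrightarrow> r i \<noteq> r j \<and> c i \<noteq> c j"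
    and adj: "\<And>i j. 1 \<le> i \<Longrightarrow> i \<le> k \<Longrightarrow> 1 \<le> j \<Longrightarrow> j \<le> k \<Longrightarrow>
        n (r i) (c j) \<longleftrightarrow> i = Suc j \<or> j = Suc i \<or> i = 1 \<and> j = 1 \<or> i = k \<and> j = k"
  shows "\<exists>g. bip_cycle V n (2 * k) g"
proof -
  define d where "d i = (if i < k then k - i else i - k + 1)" for i
  \<comment> \<open>The parity of \<open>i + k\<close> makes the sides alternate and puts
    \<open>r 1\<close> and \<open>c 1\<close> at positions \<open>k - 1\<close> and
    \<open>k\<close>. For even \<open>k\<close> the rows land on odd positions, which is harmless as
    \<open>n\<close> is symmetric.\<close>
  define g where "g i = (if odd (i + k) then r (d i) else c (d i))" for i
  have d: "1 \<le> d i" "d i \<le> k" if "i < 2 * k" for i using that by (auto simp: d_def)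
  have gne: "g i \<noteq> g j" if "i < 2 * k" "j < 2 * k" "even i = even j" "i \<noteq> j" for i j
  proof -
    have "d i \<noteq> d j"
    proof (cases "(i < k) = (j < k)")
      case True
      then show ?thesis using that by (auto simp: d_def)
    next
      case False
      \<comment> \<open>Equal indices in different halves would force positions of opposite
        parity.\<close>
      then have "d i = d j \<Longrightarrow> Suc (i + j) = 2 * k"
        using that by (auto simp: d_def split: if_splits)
      moreover have "odd (Suc (i + j))" using that by simp
      ultimately show ?thesis by (metis dvd_triv_left)
    qed
    then show ?thesis
      using that inj[of "d i" "d j"] inj[of "d j" "d i"] d[of i] d[of j]
      by (cases "d i < d j") (auto simp: g_def)
  qed
  have mod: "Suc i mod (2 * k) = (if Suc i = 2 * k then 0 else Suc i)" if "i < 2 * k" for i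
    using that by auto
  have gadj: "n (g i) (g j) \<longleftrightarrow> j = Suc i mod (2 * k) \<or> i = Suc j mod (2 * k)"
    if ij: "i < 2 * k" "j < 2 * k" "even i \<noteq> even j" for i j
  proof -
    have *: "n (g i) (g j) \<longleftrightarrow>
        d i = Suc (d j) \<or> d j = Suc (d i) \<or> d i = 1 \<and> d j = 1 \<or> d i = k \<and> d j = k"
      using ij adj[of "d i" "d j"] adj[of "d j" "d i"] d[of i] d[of j]
      by (auto simp: g_def n_commute[of "c _" "r _"])
    have ne: "i \<noteq> j" using ij(3) by auto
    \<comment> \<open>As \<open>i + j + 1\<close> is even, indices from different halves are equal
      or differ by at least 2. Adjacency across the halves thus occurs only between 1 and 1 in the
      middle and between \<open>k\<close> and \<open>k\<close> at the ends.\<close>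
    have far: "Suc (i + j) = 2 * k \<or> \<bar>int (Suc (i + j)) - 2 * int k\<bar> \<ge> 2"
      using ij(3) by presburger
    consider "i < k" "j < k" | "k \<le> i" "k \<le> j" | "i < k" "k \<le> j" | "k \<le> i" "j < k"
      by linarith
    then show ?thesis
    proof cases
      case 1
      then have "d i = Suc (d j) \<longleftrightarrow> j = Suc i" "d j = Suc (d i) \<longleftrightarrow> i = Suc j" "d i \<noteq> d j"
        using ne by (auto simp: d_def)
      then have "n (g i) (g j) \<longleftrightarrow> j = Suc i \<or> i = Suc j" unfolding * by metis
      then show ?thesis unfolding mod[OF ij(1)] mod[OF ij(2)] using 1 k ij(1,2) by simp
    next
      case 2
      then have "d i = Suc (d j) \<longleftrightarrow> i = Suc j" "d j = Suc (d i) \<longleftrightarrow> j = Suc i" "d i \<noteq> d j"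
        using ne by (auto simp: d_def)
      then have "n (g i) (g j) \<longleftrightarrow> j = Suc i \<or> i = Suc j" unfolding * by metis
      then show ?thesis unfolding mod[OF ij(1)] mod[OF ij(2)] using 2 k ij(1,2) by simp
    next
      case 3
      then have dd: "d i = k - i" "d j = j - k + 1" by (auto simp: d_def)
      have "k - i = 1 \<and> j - k + 1 = 1 \<longleftrightarrow> j = Suc i"
          "k - i = k \<and> j - k + 1 = k \<longleftrightarrow> i = 0 \<and> Suc j = 2 * k"
          "k - i \<noteq> Suc (j - k + 1)" "j - k + 1 \<noteq> Suc (k - i)"
        using 3 k far by linarith+
      then show ?thesis unfolding * mod[OF ij(1)] mod[OF ij(2)] dd using 3 k by auto
    next
      case 4
      then have dd: "d j = k - j" "d i = i - k + 1" by (auto simp: d_def)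
      have "k - j = 1 \<and> i - k + 1 = 1 \<longleftrightarrow> i = Suc j"
          "k - j = k \<and> i - k + 1 = k \<longleftrightarrow> j = 0 \<and> Suc i = 2 * k"
          "k - j \<noteq> Suc (i - k + 1)" "i - k + 1 \<noteq> Suc (k - j)"
        using 4 k far by linarith+
      then show ?thesis unfolding * mod[OF ij(1)] mod[OF ij(2)] dd using 4 k by auto
    qed
  qed
  have "g i \<in> V" if "i < 2 * k" for i
    using V[OF d[OF that]] by (auto simp: g_def)
  then have "bip_cycle V n (2 * k) g"
    unfolding bip_cycle_def using k gne gadj by auto
  then show ?thesis by blast
qed

text \<open>The new row and the new column both come from the old ladder, so only their common entry
  is open. A one there would close an induced cycle; a zero continues the pattern.\<close>

lemma ladder_extend:
  assumes no: "\<And>L g. \<not> bip_cycle V n L g" and lad: "ladder k r c" and k: "k \<ge> 2"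
  shows "\<exists>r c. ladder (Suc k) r c"
proof -
  obtain y where y: "y \<in> V" "s (c k) < s y" "n (r k) y"
      "\<And>i. 1 \<le> i \<Longrightarrow> i < k \<Longrightarrow> \<not> n (r i) y"
      "\<And>z. z \<in> V \<Longrightarrow> s y < s z \<Longrightarrow> n (r (k - 1)) z = n (r k) z"
    using ladder_extend_half[OF lad k] by blast
  obtain x where x: "x \<in> V" "s (r k) < s x" "n (c k) x"
      "\<And>i. 1 \<le> i \<Longrightarrow> i < k \<Longrightarrow> \<not> n (c i) x"
      "\<And>z. z \<in> V \<Longrightarrow> s x < s z \<Longrightarrow> n (c (k - 1)) z = n (c k) z"
    using ladder_extend_half[OF ladder_commute[OF lad] k] by blast
  define r' where "r' = r(Suc k := x)"
  define c' where "c' = c(Suc k := y)"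
  have hl: "half_ladder k r c" "half_ladder k c r"
    and adj: "\<And>i j. 1 \<le> i \<Longrightarrow> i \<le> k \<Longrightarrow> 1 \<le> j \<Longrightarrow> j \<le> k \<Longrightarrow>
        n (r i) (c j) \<longleftrightarrow> i = Suc j \<or> j = Suc i \<or> i = 1 \<and> j = 1"
    using lad by (auto simp: ladder_def)
  have hl': "half_ladder (Suc k) r' c'" "half_ladder (Suc k) c' r'"
    using hl x y unfolding half_ladder_def r'_def c'_def
    by (auto simp: less_Suc_eq le_Suc_eq)
  have old: "n (r' i) (c' j) \<longleftrightarrow> i = Suc j \<or> j = Suc i \<or> i = 1 \<and> j = 1"
    if ij: "1 \<le> i" "i \<le> Suc k" "1 \<le> j" "j \<le> Suc k" "\<not> (i = Suc k \<and> j = Suc k)" for i j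
  proof -
    consider "i \<le> k" "j \<le> k" | "i = Suc k" "j \<le> k" | "i \<le> k" "j = Suc k"
      using ij by linarith
    then show ?thesis
    proof cases
      case 1
      then show ?thesis using adj ij by (auto simp: r'_def c'_def)
    next
      case 2
      then show ?thesis using x(3) x(4)[of j] ij k
        by (cases "j = k") (auto simp: r'_def c'_def n_commute[of x])
    next
      case 3
      then show ?thesis using y(3) y(4)[of i] ij k
        by (cases "i = k") (auto simp: r'_def c'_def)
    qed
  qed
  have "\<not> n (r' (Suc k)) (c' (Suc k))"
  proof
    assume top: "n (r' (Suc k)) (c' (Suc k))"
    have "\<exists>g. bip_cycle V n (2 * Suc k) g"
    proof (rule bip_cycle_of_closed_ladder)
      show "Suc k \<ge> 3" using k by simp
      show "r' i \<in> V \<and> c' i \<in> V" if "1 \<le> i" "i \<le> Suc k" for i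
        using hl' that by (auto simp: half_ladder_def)
      show "r' i \<noteq> r' j \<and> c' i \<noteq> c' j" if "1 \<le> i" "i < j" "j \<le> Suc k" for i j
        using half_ladder_mono[OF hl'(1) that] half_ladder_mono[OF hl'(2) that] by auto
      show "n (r' i) (c' j) \<longleftrightarrow>
          i = Suc j \<or> j = Suc i \<or> i = 1 \<and> j = 1 \<or> i = Suc k \<and> j = Suc k"
        if "1 \<le> i" "i \<le> Suc k" "1 \<le> j" "j \<le> Suc k" for i j
        using old[OF that] top by (cases "i = Suc k \<and> j = Suc k") auto
    qed
    then show False using no by blast
  qed
  then have "ladder (Suc k) r' c'"
    unfolding ladder_def
  proof (intro conjI allI impI hl')
    fix i j assume "1 \<le> i \<and> i \<le> Suc k \<and> 1 \<le> j \<and> j \<le> Suc k"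
    then show "n (r' i) (c' j) \<longleftrightarrow> i = Suc j \<or> j = Suc i \<or> i = 1 \<and> j = 1"
      using old[of i j] \<open>\<not> n (r' (Suc k)) (c' (Suc k))\<close> k
      by (cases "i = Suc k \<and> j = Suc k") auto
  qed
  then show ?thesis by blast
qed

text \<open>A violation is a ladder of length 2 with rows \<open>u\<close>, \<open>w\<close> and
  columns \<open>v\<close>, \<open>x\<close>. Without induced cycles it grows to any length, whereas
  its rows are distinct members of the finite set \<open>V\<close>.\<close>

lemma least_vertex_nested:
  assumes no: "\<And>L g. \<not> bip_cycle V n L g"
    and v: "v \<in> V" "\<And>x. x \<in> V \<Longrightarrow> s v \<le> s x"
    and u: "u \<in> V" "n v u" and w: "w \<in> V" "n v w" and uw: "s u < s w"
    and x: "x \<in> V" "n u x"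
  shows "n w x"
proof (rule ccontr)
  assume nx: "\<not> n w x"
  define r where "r = (\<lambda>i::nat. if i = 1 then u else w)"
  define c where "c = (\<lambda>i::nat. if i = 1 then v else x)"
  have "x \<noteq> v" using nx w(2) n_commute by auto
  then have "s v \<noteq> s x" using inj_s v x by (auto dest: inj_onD)
  then have vx: "s v < s x" using v(2)[OF x(1)] by simp
  have "ladder 2 r c"
  proof -
    \<comment> \<open>For length 2 the agreement clause of \<open>half_ladder\<close> is vacuous;
      what counts is that \<open>u\<close> precedes \<open>w\<close> and \<open>v\<close> precedes
      \<open>x\<close>.\<close>
    have "half_ladder 2 r c" "half_ladder 2 c r"
      using u w v x uw vx by (auto simp: half_ladder_def r_def c_def)
    moreover have "n (r i) (c j) \<longleftrightarrow> i = Suc j \<or> j = Suc i \<or> i = 1 \<and> j = 1"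
      if "1 \<le> i" "i \<le> 2" "1 \<le> j" "j \<le> 2" for i j
    proof -
      have "i = 1 \<or> i = 2" "j = 1 \<or> j = 2" using that by auto
      then show ?thesis using u w x nx by (auto simp: r_def c_def n_commute[of _ v])
    qed
    ultimately show ?thesis by (auto simp: ladder_def)
  qed
  then have "\<exists>r c. ladder (2 + l) r c" for l
  proof (induction l)
    case (Suc l)
    then show ?case using ladder_extend[OF no, of "2 + l"] by auto
  qed auto
  then obtain r c where lad: "ladder (2 + card V) r c" by blast
  then have hl: "half_ladder (2 + card V) c r" by (auto simp: ladder_def)
  have "inj_on r {1..2 + card V}"
  proof (rule inj_onI)
    fix i j assume "i \<in> {1..2 + card V}" "j \<in> {1..2 + card V}" "r i = r j"
    then show "i = j"
      using half_ladder_mono[OF hl, of i j] half_ladder_mono[OF hl, of j i]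
      by (cases i j rule: linorder_cases) auto
  qed
  moreover have "r ` {1..2 + card V} \<subseteq> V" using hl by (auto simp: half_ladder_def)
  ultimately have "card {1..2 + card V} \<le> card V" using finite_V by (metis card_inj_on_le)
  then show False by simp
qed

end

section \<open>Simple vertices of strongly chordal graphs\<close>

text \<open>Reflexive, so that the rows of the matrix are closed neighbourhoods and its diagonal
  consists of ones, as the ordering requires.\<close>

definition nadj :: "'a set set \<Rightarrow> 'a \<Rightarrow> 'a \<Rightarrow> bool" where
  "nadj E x y \<longleftrightarrow> x = y \<or> {x, y} \<in> E"

lemma nadj_refl [simp]: "nadj E x x"
  by (simp add: nadj_def)

lemma nadj_sym: "nadj E x y \<Longrightarrow> nadj E y x"
  by (auto simp: nadj_def insert_commute)

lemma simple_graph_edgeD: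
  assumes "simple_graph V E" "{x, y} \<in> E"
  shows "x \<in> V" "y \<in> V" "x \<noteq> y"
  using assms by (force simp: simple_graph_def doubleton_eq_iff)+

lemma simple_graph_edgeE:
  assumes "simple_graph V E" "e \<in> E"
  obtains x y where "e = {x, y}" "x \<in> V" "y \<in> V" "x \<noteq> y"
  using assms by (auto simp: simple_graph_def)

text \<open>A shortest such walk closes up with \<open>x\<close> to an induced cycle.\<close>

lemma chordal_no_walk_around:
  assumes graph: "simple_graph V E" and chordal: "chordal V E"
    and W: "W \<subseteq> V" "x \<in> V" "x \<notin> W"
    and xa: "nadj E x a" and xb: "nadj E x b" and ab: "\<not> nadj E a b"
    and far: "\<And>w. w \<in> W \<Longrightarrow> w \<noteq> a \<Longrightarrow> w \<noteq> b \<Longrightarrow> \<not> nadj E x w"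
    and walk: "q 0 = a" "q l = b" "\<And>i. i \<le> l \<Longrightarrow> q i \<in> W"
      "\<And>i. i < l \<Longrightarrow> nadj E (q i) (q (Suc i))"
  shows False
proof -
  define is_walk where "is_walk m p \<longleftrightarrow> p 0 = a \<and> p m = b \<and> (\<forall>i\<le>m. p i \<in> W) \<and>
    (\<forall>i<m. nadj E (p i) (p (Suc i)))" for m and p :: "nat \<Rightarrow> 'a"
  have "is_walk l q" using walk by (auto simp: is_walk_def)
  then obtain m p where p: "is_walk m p" and least: "\<And>m' p'. is_walk m' p' \<Longrightarrow> m \<le> m'"
    using ex_has_least_nat[of "\<lambda>m. \<exists>p. is_walk m p" l "\<lambda>m. m"] by blast
  have p0: "p 0 = a" and pm: "p m = b" and pW: "\<And>i. i \<le> m \<Longrightarrow> p i \<in> W"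
    and step: "\<And>i. i < m \<Longrightarrow> nadj E (p i) (p (Suc i))"
    using p by (auto simp: is_walk_def)
  have m: "m \<ge> 2"
  proof (rule ccontr)
    assume "\<not> m \<ge> 2"
    then have "m = 0 \<or> m = 1" by auto
    then show False using p0 pm step[of 0] ab by auto
  qed
  \<comment> \<open>Since \<open>nadj\<close> includes equality, this excludes repetitions as well
    as chords: skipping the \<open>d\<close> vertices after \<open>p i\<close> would give a shorter
    walk.\<close>
  have nochord: "\<not> nadj E (p i) (p (i + 1 + d))" if "d \<ge> 1" "i + 1 + d \<le> m" for i d
  proof
    assume chord: "nadj E (p i) (p (i + 1 + d))"
    define p' where "p' j = (if j \<le> i then p j else p (j + d))" for j
    have "nadj E (p' j) (p' (Suc j))" if "j < m - d" for j
      using that chord step[of j] step[of "j + d"] \<open>i + 1 + d \<le> m\<close>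
      by (cases j i rule: linorder_cases) (auto simp: p'_def)
    moreover have "p' j \<in> W" if "j \<le> m - d" for j
      using that pW \<open>i + 1 + d \<le> m\<close> by (auto simp: p'_def)
    ultimately have "is_walk (m - d) p'"
      using p0 pm that by (auto simp: is_walk_def p'_def)
    then show False using least[of "m - d" p'] that by linarith
  qed
  \<comment> \<open>A stutter allows a shortcut from \<open>p i\<close> to \<open>p (i + 2)\<close>
    or, at the end of the walk, the omission of its last vertex.\<close>
  have psuc: "p i \<noteq> p (Suc i)" if "i < m" for i
  proof
    assume eq: "p i = p (Suc i)"
    show False
    proof (cases "Suc i < m")
      case True
      then show False using nochord[of 1 i] step[of "Suc i"] eq by auto
    next
      case False
      then have "m = Suc i" using that by simp
      then have "is_walk i p" using p eq by (auto simp: is_walk_def)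
      then show False using least[of i p] that by linarith
    qed
  qed
  have pfar: "\<not> nadj E (p i) (p j)" if "Suc i < j" "j \<le> m" for i j
    using nochord[of "j - Suc i" i] that by auto
  have pne: "p i \<noteq> p j" if "i < j" "j \<le> m" for i j
    using psuc[of i] pfar[of i j] that by (cases "j = Suc i") auto
  have xp: "\<not> nadj E x (p i)" if "0 < i" "i < m" for i
    using far[of "p i"] pW[of i] pne[of 0 i] pne[of i m] p0 pm that by auto
  have xne: "x \<noteq> p i" if "i \<le> m" for i using pW[OF that] W by auto
  have edge: "{p i, p (Suc i)} \<in> E" if "i < m" for i
    using step[OF that] psuc[OF that] by (auto simp: nadj_def)
  have xedge: "{x, p 0} \<in> E" "{x, p m} \<in> E"
    using xa xb xne[of 0] xne[of m] p0 pm by (auto simp: nadj_def)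
  \<comment> \<open>Placing \<open>x\<close> first shifts the indices of the walk by one; as
    \<open>m\<close> is at least 2, the cycle has length \<open>m + 2 >= 4\<close>.\<close>
  define c where "c = x # map p [0..<Suc m]"
  have len: "length c = m + 2" by (simp add: c_def)
  have nth0: "c ! 0 = x" and nthS: "\<And>i. i \<le> m \<Longrightarrow> c ! Suc i = p i"
    by (auto simp: c_def simp del: upt_Suc)
  have set_c: "set c = insert x (p ` {..m})"
    by (auto simp: c_def image_iff less_Suc_eq_le simp del: upt_Suc)
  have ce: "cycle_edges c = insert {x, p 0} (insert {x, p m} {{p i, p (Suc i)} | i. i < m})"
  proof (intro equalityI subsetI)
    fix e assume "e \<in> cycle_edges c"
    then obtain i where i: "i < m + 2" "e = {c ! i, c ! (Suc i mod (m + 2))}"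
      by (auto simp: cycle_edges_def len)
    consider "i = 0" | j where "i = Suc j" "j < m" | "i = Suc m"
      using i(1) by (cases i) (auto simp: less_Suc_eq)
    then show "e \<in> insert {x, p 0} (insert {x, p m} {{p i, p (Suc i)} | i. i < m})"
    proof cases
      case 1
      then show ?thesis using i nth0 nthS[of 0] by auto
    next
      case 2
      then show ?thesis using i nthS[of j] nthS[of "Suc j"] by auto
    next
      case 3
      then show ?thesis using i nth0 nthS[of m] by auto
    qed
  next
    fix e assume "e \<in> insert {x, p 0} (insert {x, p m} {{p i, p (Suc i)} | i. i < m})"
    then consider "e = {x, p 0}" | "e = {x, p m}" | j where "j < m" "e = {p j, p (Suc j)}"
      by auto
    then have "\<exists>i<m + 2. e = {c ! i, c ! (Suc i mod (m + 2))}"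
    proof cases
      case 1
      then show ?thesis using nth0 nthS[of 0] by (intro exI[of _ 0]) auto
    next
      case 2
      then show ?thesis using nth0 nthS[of m] by (intro exI[of _ "Suc m"]) auto
    next
      case 3
      then show ?thesis using nthS[of j] nthS[of "Suc j"] by (intro exI[of _ "Suc j"]) auto
    qed
    then show "e \<in> cycle_edges c" by (auto simp: cycle_edges_def len)
  qed
  have "inj_on p {0..<Suc m}"
    by (intro linorder_inj_onI') (use pne in auto)
  then have "distinct c"
    using xne by (force simp: c_def distinct_map less_Suc_eq_le simp del: upt_Suc)
  moreover have "set c \<subseteq> V" using set_c W pW by auto
  moreover have ceE: "cycle_edges c \<subseteq> E" unfolding ce using xedge edge by auto
  ultimately have "is_cycle V E c" using m by (simp add: is_cycle_def len)
  moreover have "induced_edges E (set c) = cycle_edges c"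
  proof (intro equalityI subsetI)
    fix e assume "e \<in> induced_edges E (set c)"
    then have e: "e \<in> E" "e \<subseteq> set c" by (auto simp: induced_edges_def)
    obtain y z where yz: "e = {y, z}" "y \<noteq> z" using graph e(1) by (rule simple_graph_edgeE)
    have xcase: "e \<in> cycle_edges c" if "e = {x, p j}" "j \<le> m" for j
    proof -
      have "j = 0 \<or> j = m" using xp[of j] that e(1) by (force simp: nadj_def)
      then show ?thesis using that by (auto simp: ce)
    qed
    have pcase: "e \<in> cycle_edges c" if "e = {p i, p j}" "i < j" "j \<le> m" for i j
    proof -
      have "j = Suc i" using pfar[of i j] that e(1) by (force simp: nadj_def)
      then show ?thesis using that by (auto simp: ce)
    qed
    consider "y = x" | "z = x" | "y \<noteq> x" "z \<noteq> x" by blast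
    then show "e \<in> cycle_edges c"
    proof cases
      case 1
      then show ?thesis using xcase e(2) yz set_c by auto
    next
      case 2
      then show ?thesis using xcase e(2) yz set_c by (auto simp: insert_commute)
    next
      case 3
      then obtain i j where ij: "y = p i" "z = p j" "i \<le> m" "j \<le> m" using e(2) yz set_c by auto
      then have "i \<noteq> j" using yz by auto
      then show ?thesis using pcase[of i j] pcase[of j i] ij yz
        by (cases "i < j") (auto simp: insert_commute)
    qed
  next
    fix e assume e: "e \<in> cycle_edges c"
    then have "e \<in> E" using ceE by auto
    moreover have "e \<subseteq> set c" using e by (auto simp: ce set_c)
    ultimately show "e \<in> induced_edges E (set c)" by (simp add: induced_edges_def)
  qed
  ultimately show False using chordal m unfolding chordal_def len[symmetric]
    by (metis add_le_mono1 len numeral_Bit0 numeral_2_eq_2)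
qed

section \<open>Excluding incidence cycles in strongly chordal graphs\<close>

lemma Suc_mod_eq: "i < L \<Longrightarrow> Suc i mod L = (if Suc i = L then 0 else Suc i)"
  by auto

text \<open>Evenness of \<open>L\<close> makes reduction modulo \<open>L\<close> respect parity, so
  a rotation keeps or swaps the two sides as a whole.\<close>

lemma bip_cycle_rotate:
  assumes "bip_cycle V n L g"
  shows "bip_cycle V n L (\<lambda>i. g ((i + a) mod L))"
proof -
  have L: "even L" "L \<ge> 6" using assms by (auto simp: bip_cycle_def)
  have lt: "(i + a) mod L < L" for i using L by simp
  have par: "even ((i + a) mod L) = even (i + a)" for i
    using L by (simp add: dvd_mod_iff)
  have canc: "(i + a) mod L = (j + a) mod L \<longleftrightarrow> i = j" if "i < L" "j < L" for i j
  proof -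
    have "i' = j'" if "i' \<le> j'" "j' < L" "(j' + a) mod L = (i' + a) mod L" for i' j'
    proof -
      have "L dvd j' - i'" using that mod_eq_dvd_iff_nat[of "i' + a" "j' + a" L] by simp
      then show ?thesis using that by (auto dest: dvd_imp_le)
    qed
    then show ?thesis using that by (cases "i \<le> j") (auto, metis nle_le)
  qed
  have suc: "(j + a) mod L = Suc ((i + a) mod L) mod L \<longleftrightarrow> j = Suc i mod L"
    if "i < L" "j < L" for i j
  proof -
    have "Suc ((i + a) mod L) mod L = (Suc i mod L + a) mod L"
      by (simp add: mod_simps)
    then show ?thesis using canc[of j "Suc i mod L"] that by simp
  qed
  have "g ((i + a) mod L) \<noteq> g ((j + a) mod L)"
    if "i < L" "j < L" "even i = even j" "i \<noteq> j" for i j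
    using assms lt par[of i] par[of j] canc[of i j] that unfolding bip_cycle_def
    by (metis even_add)
  moreover have "n (g ((i + a) mod L)) (g ((j + a) mod L)) \<longleftrightarrow> j = Suc i mod L \<or> i = Suc j mod L"
    if ij: "i < L" "j < L" "even i \<noteq> even j" for i j
  proof -
    have "even ((i + a) mod L) \<noteq> even ((j + a) mod L)" using par ij(3) by auto
    then show ?thesis using assms lt suc[OF ij(1,2)] suc[OF ij(2,1)] unfolding bip_cycle_def
      by blast
  qed
  moreover have "g ((i + a) mod L) \<in> V" for i
    using assms lt by (auto simp: bip_cycle_def)
  ultimately show ?thesis
    using L by (simp add: bip_cycle_def)
qed

text \<open>If a vertex occurs both as a row and as a column, the two occurrences are consecutive, and its
  other two neighbours on the cycle are non-adjacent and joined by the rest of the cycle.\<close>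

lemma strongly_chordal_no_bip_cycle:
  assumes graph: "simple_graph V E" and sc: "strongly_chordal V E"
  shows "\<not> bip_cycle V (nadj E) L g"
proof
  assume bip: "bip_cycle V (nadj E) L g"
  show False
  proof (cases "inj_on g {0..<L}")
    case True
    have L: "even L" "L \<ge> 6" using bip by (auto simp: bip_cycle_def)
    have adj: "nadj E (g i) (g j) \<longleftrightarrow> j = Suc i mod L \<or> i = Suc j mod L"
      if "i < L" "j < L" "even i \<noteq> even j" for i j
      using bip that by (auto simp: bip_cycle_def)
    define c where "c = map g [0..<L]"
    have len: "length c = L" and nth: "\<And>i. i < L \<Longrightarrow> c ! i = g i" by (auto simp: c_def)
    have mod_lt: "Suc i mod L < L" for i using L by simp
    have edge: "{c ! i, c ! (Suc i mod L)} \<in> E" if i: "i < L" for i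
    proof -
      have par: "even i \<noteq> even (Suc i mod L)" using L by (simp add: dvd_mod_iff)
      then have "i \<noteq> Suc i mod L" by auto
      then have "g i \<noteq> g (Suc i mod L)" using True i mod_lt by (auto dest: inj_onD)
      then show ?thesis using adj[OF i mod_lt par] i mod_lt by (simp add: nth nadj_def)
    qed
    have "distinct c" using True by (simp add: c_def distinct_map)
    moreover have "set c \<subseteq> V" using bip by (auto simp: bip_cycle_def c_def)
    moreover have "cycle_edges c \<subseteq> E" using edge by (auto simp: cycle_edges_def len)
    ultimately have "is_cycle V E c" using L by (simp add: is_cycle_def len)
    then have "has_odd_chord E c" using sc L by (simp add: strongly_chordal_def len)
    then obtain i j where ij: "i < L" "j < L" "{c ! i, c ! j} \<in> E" "{c ! i, c ! j} \<notin> cycle_edges c"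
        "odd (cycle_dist c i j)"
      by (auto simp: has_odd_chord_def len)
    \<comment> \<open>As the length is even, both arcs between two positions have the same parity,
      so an odd distance means positions of opposite parity.\<close>
    have "even i \<noteq> even j"
      using ij(1,2,5) L(1) by (auto simp: cycle_dist_def Let_def len min_def max_def split: if_splits)
    then have "j = Suc i mod L \<or> i = Suc j mod L"
      using adj[OF ij(1,2)] ij by (simp add: nth nadj_def)
    then have "{c ! i, c ! j} \<in> cycle_edges c"
      using ij(1,2) unfolding cycle_edges_def len by (auto simp: insert_commute)
    then show False using ij(4) by simp
  next
    case False
    then obtain i j where ij: "i < L" "j < L" "i \<noteq> j" "g i = g j" by (auto simp: inj_on_def)
    have "even i \<noteq> even j" using bip ij by (auto simp: bip_cycle_def)
    moreover have "nadj E (g i) (g j)" using ij by simp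
    ultimately have "j = Suc i mod L \<or> i = Suc j mod L"
      using bip ij(1,2) unfolding bip_cycle_def by blast
    then obtain a where a: "a < L" "g a = g (Suc a mod L)" using ij by metis
    \<comment> \<open>The rotation moves the two occurrences of the repeated vertex to positions
      \<open>L - 1\<close> and 0.\<close>
    define h where "h i = g ((i + Suc a) mod L)" for i
    have hb: "bip_cycle V (nadj E) L h" unfolding h_def by (rule bip_cycle_rotate[OF bip])
    then have L: "even L" "L \<ge> 6" by (auto simp: bip_cycle_def)
    have adj: "nadj E (h i) (h j) \<longleftrightarrow> j = Suc i mod L \<or> i = Suc j mod L"
      if "i < L" "j < L" "even i \<noteq> even j" for i j
      using hb that by (auto simp: bip_cycle_def)
    have hne: "h i \<noteq> h j" if "i < L" "j < L" "even i = even j" "i \<noteq> j" for i j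
      using hb that by (auto simp: bip_cycle_def)
    have "(L - 1 + Suc a) mod L = a" using a L by simp
    then have h0: "h 0 = h (L - 1)" using a by (simp add: h_def)
    have oddL: "odd (L - 1)" using L by simp
    \<comment> \<open>The repeated vertex occurs at both parities: the occurrence of parity opposite
      to \<open>i\<close> decides adjacency, and in the next step the one of equal parity decides
      distinctness.\<close>
    have far: "\<not> nadj E (h 0) (h i)" if "2 \<le> i" "i \<le> L - 3" for i
    proof (cases "even i")
      case True
      then show ?thesis unfolding h0 using that adj[of "L - 1" i] oddL L by (auto simp: Suc_mod_eq)
    next
      case False
      then show ?thesis using that adj[of 0 i] L by (auto simp: Suc_mod_eq)
    qed
    have hx: "h 0 \<noteq> h i" if "1 \<le> i" "i \<le> L - 2" for i
    proof (cases "even i")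
      case True
      then show ?thesis using that hne[of 0 i] L by auto
    next
      case False
      then show ?thesis unfolding h0 using that hne[of "L - 1" i] oddL L by auto
    qed
    show False
    proof (rule chordal_no_walk_around[OF graph, where x = "h 0" and a = "h 1" and b = "h (L - 2)"
        and W = "h ` {1..L - 2}" and q = "\<lambda>i. h (Suc i)" and l = "L - 3"])
      show "chordal V E" using sc by (simp add: strongly_chordal_def)
      show "h ` {1..L - 2} \<subseteq> V" "h 0 \<in> V" using hb L by (auto simp: bip_cycle_def)
      show "h 0 \<notin> h ` {1..L - 2}" 
      proof
        assume "h 0 \<in> h ` {1..L - 2}"
        then obtain i where "h 0 = h i" "i \<in> {1..L - 2}" by (rule imageE)
        then show False using hx[of i] by simp
      qed
      show "nadj E (h 0) (h 1)" using adj[of 0 1] L by (auto simp: Suc_mod_eq)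
      show "nadj E (h 0) (h (L - 2))" unfolding h0
        using adj[of "L - 1" "L - 2"] L by (auto simp: Suc_mod_eq)
      show "\<not> nadj E (h 1) (h (L - 2))"
        using adj[of 1 "L - 2"] L by (auto simp: Suc_mod_eq)
      show "\<not> nadj E (h 0) w" if w: "w \<in> h ` {1..L - 2}" "w \<noteq> h 1" "w \<noteq> h (L - 2)" for w
      proof -
        obtain i where i: "w = h i" "1 \<le> i" "i \<le> L - 2" using w(1) by auto
        then have "i \<noteq> 1" "i \<noteq> L - 2" using w(2,3) by auto
        then show ?thesis using far[of i] i by auto
      qed
      show "h (Suc 0) = h 1" "h (Suc (L - 3)) = h (L - 2)"
        using L by (auto simp: numeral_eq_Suc Suc_diff_Suc)
      show "h (Suc i) \<in> h ` {1..L - 2}" if "i \<le> L - 3" for i using that L by auto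
      show "nadj E (h (Suc i)) (h (Suc (Suc i)))" if "i < L - 3" for i
        using that adj[of "Suc i" "Suc (Suc i)"] by (auto simp: Suc_mod_eq)
    qed
  qed
qed

section \<open>Closed neighbourhoods and the existence of a simple vertex\<close>

definition nbhd :: "'a set set \<Rightarrow> 'a \<Rightarrow> 'a set" where
  "nbhd E x = {y. nadj E x y}"

definition simple_vertex :: "'a set set \<Rightarrow> 'a \<Rightarrow> bool" where
  "simple_vertex E v \<longleftrightarrow>
     (\<forall>u\<in>nbhd E v. \<forall>w\<in>nbhd E v. nbhd E u \<subseteq> nbhd E w \<or> nbhd E w \<subseteq> nbhd E u)"

lemma nbhd_self: "x \<in> nbhd E x"
  by (simp add: nbhd_def)

lemma nbhd_commute: "y \<in> nbhd E x \<longleftrightarrow> x \<in> nbhd E y"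
  unfolding nbhd_def by (auto dest: nadj_sym)

lemma edge_in_nbhd: "{x, y} \<in> E \<Longrightarrow> y \<in> nbhd E x"
  by (simp add: nbhd_def nadj_def)

lemma nbhd_edge: "y \<in> nbhd E x \<Longrightarrow> x \<noteq> y \<Longrightarrow> {x, y} \<in> E"
  by (simp add: nbhd_def nadj_def)

lemma nbhd_subset:
  assumes "simple_graph V E" "x \<in> V"
  shows "nbhd E x \<subseteq> V"
  using assms simple_graph_edgeD[OF assms(1)] by (auto simp: nbhd_def nadj_def)

text \<open>The first vertex of a doubly lexical ordering of the closed neighbourhood matrix works:
  among its neighbours, later ones have closed neighbourhoods containing those of earlier
  ones.\<close>

lemma strongly_chordal_simple_vertex:
  assumes graph: "simple_graph V E" and sc: "strongly_chordal V E" and "V \<noteq> {}"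
  shows "\<exists>v\<in>V. simple_vertex E v"
proof -
  have fin: "finite V" using graph by (simp add: simple_graph_def)
  obtain s where s: "lexically_ordered V (nadj E) s"
    using lexically_ordered_exists[OF fin, of "nadj E"] nadj_sym by fastforce
  interpret lexically_ordered V "nadj E" s by (fact s)
  obtain v where v: "v \<in> V" "\<And>x. x \<in> V \<Longrightarrow> s v \<le> s x"
    using ex_has_least_nat[of "\<lambda>x. x \<in> V" _ s] \<open>V \<noteq> {}\<close> by blast
  have sub: "nbhd E u \<subseteq> nbhd E w" if "u \<in> nbhd E v" "w \<in> nbhd E v" "s u < s w" for u w
  proof
    fix x assume x: "x \<in> nbhd E u"
    have "u \<in> V" "w \<in> V" using nbhd_subset[OF graph v(1)] that by auto
    moreover have "x \<in> V" using nbhd_subset[OF graph \<open>u \<in> V\<close>] x by auto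
    ultimately show "x \<in> nbhd E w"
      using least_vertex_nested[OF strongly_chordal_no_bip_cycle[OF graph sc] v, of u w x] x that
      by (simp add: nbhd_def)
  qed
  have "nbhd E u \<subseteq> nbhd E w \<or> nbhd E w \<subseteq> nbhd E u" if "u \<in> nbhd E v" "w \<in> nbhd E v" for u w
  proof (cases "s u = s w")
    case True
    then have "u = w" using that nbhd_subset[OF graph v(1)] inj_s by (auto dest: inj_onD)
    then show ?thesis by simp
  next
    case False
    then show ?thesis using sub[of u w] sub[of w u] that by linarith
  qed
  then show ?thesis using v(1) unfolding simple_vertex_def by blast
qed

section \<open>Toughness and edge-invariant labellings\<close>

text \<open>A label constant along edges is constant on components, so components map onto labels.
  Toughness can thus be tested with explicit labellings, without computing components.\<close>

lemma card_labels_le_num_components: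
  assumes "finite W" and const: "\<And>x y. x \<in> W \<Longrightarrow> y \<in> W \<Longrightarrow> {x, y} \<in> E \<Longrightarrow> f x = f y"
  shows "card (f ` W) \<le> num_components W (induced_edges E W)"
proof -
  define R where "R = connected_in W (induced_edges E W)"
  have "f x = f y" if "(x, y) \<in> {(x, y). {x, y} \<in> induced_edges E W}\<^sup>*" for x y
    using that by (induction rule: rtrancl_induct) (auto simp: induced_edges_def const)
  then have "f ` (R `` {x}) = {f x}" if "x \<in> W" for x
    using that by (auto simp: R_def connected_in_def)
  then have "f ` W \<subseteq> (\<lambda>C. the_elem (f ` C)) ` (W // R)"
    by (auto simp: quotient_def image_iff)
  moreover have "finite (W // R)"
    using assms(1) by (simp add: quotient_def)
  ultimately show ?thesis
    unfolding num_components_def R_def[symmetric] using card_image_le card_mono finite_imageI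
    by (meson order_trans)
qed

text \<open>As \<open>t\<close> is nonnegative, the bound for the components carries over to the
  labels, of which there are no more.\<close>

lemma tough_card_labels_le:
  assumes "tough t V E" "finite V" "t \<ge> 0" "S \<subseteq> V"
    and "\<And>x y. x \<in> V - S \<Longrightarrow> y \<in> V - S \<Longrightarrow> {x, y} \<in> E \<Longrightarrow> f x = f y"
    and "card (f ` (V - S)) > 1"
  shows "t * card (f ` (V - S)) \<le> card S"
proof -
  define c where "c = num_components (V - S) (induced_edges E (V - S))"
  have le: "card (f ` (V - S)) \<le> c"
    unfolding c_def using assms by (intro card_labels_le_num_components) auto
  then have "t * card (f ` (V - S)) \<le> t * c"
    using assms(3) by (intro mult_left_mono) auto
  also have "\<dots> \<le> card S"
    using assms(1,4,6) le unfolding tough_def c_def by auto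
  finally show ?thesis .
qed

text \<open>Conversely, labelling each vertex with its component loses nothing; hence the labels are
  sets of vertices.\<close>

lemma not_tough_labels:
  fixes t :: real
  assumes "\<not> tough t V E"
  obtains S and f :: "'a \<Rightarrow> 'a set" where "S \<subseteq> V"
    "\<And>x y. x \<in> V - S \<Longrightarrow> y \<in> V - S \<Longrightarrow> {x, y} \<in> E \<Longrightarrow> f x = f y"
    "card (f ` (V - S)) > 1" "card S < t * card (f ` (V - S))"
proof -
  obtain S where S: "S \<subseteq> V" "num_components (V - S) (induced_edges E (V - S)) > 1"
    "card S < t * num_components (V - S) (induced_edges E (V - S))"
    using assms by (auto simp: tough_def not_le)
  define T where "T = {(x, y). {x, y} \<in> induced_edges E (V - S)}"
  define f where "f x = connected_in (V - S) (induced_edges E (V - S)) `` {x}" for x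
  have card: "card (f ` (V - S)) = num_components (V - S) (induced_edges E (V - S))"
    unfolding num_components_def f_def quotient_def by (simp add: UNION_singleton_eq_range)
  have "f x = f y" if "x \<in> V - S" "y \<in> V - S" "{x, y} \<in> E" for x y
  proof -
    have "(x, y) \<in> T" "(y, x) \<in> T"
      using that by (auto simp: T_def induced_edges_def insert_commute)
    then have "(x, z) \<in> T\<^sup>* \<longleftrightarrow> (y, z) \<in> T\<^sup>*" for z
      by (meson converse_rtrancl_into_rtrancl)
    then show ?thesis using that unfolding f_def connected_in_def T_def[symmetric] by auto
  qed
  then show ?thesis using that[of S f] S card by auto
qed

section \<open>A simple vertex excludes minimal toughness\<close>

text \<open>For \<open>u\<close>, \<open>w\<close> in \<open>nbhd E v\<close> the closed
  neighbourhoods are comparable and contain their own vertices, so \<open>u\<close> and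
  \<open>w\<close> are adjacent or equal.\<close>

lemma simple_vertex_clique:
  assumes "simple_vertex E v" "u \<in> nbhd E v"
  shows "nbhd E v \<subseteq> nbhd E u"
proof
  fix w assume "w \<in> nbhd E v"
  then have "nbhd E u \<subseteq> nbhd E w \<or> nbhd E w \<subseteq> nbhd E u"
    using assms by (auto simp: simple_vertex_def)
  then show "w \<in> nbhd E u"
    using nbhd_self[of u E] nbhd_self[of w E] nbhd_commute[of u E w] by blast
qed

lemma simple_vertex_not_minimally_tough:
  fixes t :: real
  assumes graph: "simple_graph V E" and t: "t > 1 / 2"
    and v: "v \<in> V" "simple_vertex E v"
  shows "\<not> minimally_tough t V E"
proof
  assume min: "minimally_tough t V E"
  have fin: "finite V" using graph by (simp add: simple_graph_def)
  have "\<not> complete_graph V E"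
    using min by (auto simp: minimally_tough_def toughness_def)
  have tough: "tough t V E"
    using min tough_iff_le_toughness[OF graph] by (simp add: minimally_tough_def)
  have clique: "nbhd E v \<subseteq> nbhd E u" if "u \<in> nbhd E v" for u
    using simple_vertex_clique[OF v(2) that] .
  have finN: "finite (nbhd E x)" if "x \<in> V" for x
    using finite_subset[OF nbhd_subset[OF graph that] fin] .
  define A where "A = nbhd E v - {v}"
  have A: "finite A" "A \<subseteq> V" "v \<notin> A"
    using finN[OF v(1)] nbhd_subset[OF graph v(1)] by (auto simp: A_def)
  have "\<not> V \<subseteq> nbhd E v"
  proof
    assume V: "V \<subseteq> nbhd E v"
    have "{x, y} \<in> E" if "x \<in> V" "y \<in> V" "x \<noteq> y" for x y
      using that V clique[of x] nbhd_edge[of y E x] by blast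
    then have "complete_graph V E"
      using graph unfolding complete_graph_def simple_graph_def by blast
    then show False using \<open>\<not> complete_graph V E\<close> by simp
  qed
  then obtain z where z: "z \<in> V" "z \<notin> nbhd E v" by blast
  \<comment> \<open>Deleting the open neighbourhood \<open>A\<close> cuts \<open>v\<close> off from
    its non-neighbour \<open>z\<close>.\<close>
  have degree: "2 * t \<le> card A"
  proof -
    have "(\<lambda>x. x = v) ` (V - A) = {True, False}"
      using v z A nbhd_self[of v E] by (force simp: A_def)
    moreover have "(x = v) = (y = v)" if "x \<in> V - A" "y \<in> V - A" "{x, y} \<in> E" for x y
      using that edge_in_nbhd[of v _ E] simple_graph_edgeD[OF graph that(3)]
      by (auto simp: A_def insert_commute)
    ultimately show ?thesis
      using tough_card_labels_le[OF tough fin, of A "\<lambda>x. x = v"] t A by auto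
  qed
  then have card_A: "card A \<ge> 2" using t by linarith
  have "A \<noteq> {}" using card_A by auto
  then obtain a where a: "a \<in> A" "\<And>u. u \<in> A \<Longrightarrow> card (nbhd E a) \<le> card (nbhd E u)"
    using ex_has_least_nat[of "\<lambda>u. u \<in> A" _ "\<lambda>u. card (nbhd E u)"] by blast
  have "card (A - {a}) \<ge> 1" using card_A a A by simp
  then have "A - {a} \<noteq> {}" by (metis card.empty not_one_le_zero)
  \<comment> \<open>Excluding \<open>a\<close> keeps the two vertices distinct even if all
    neighbours of \<open>v\<close> have closed neighbourhoods of the same size.\<close>
  then obtain b where b: "b \<in> A - {a}"
    "\<And>u. u \<in> A - {a} \<Longrightarrow> card (nbhd E u) \<le> card (nbhd E b)"
    using ex_has_greatest_nat[of "\<lambda>u. u \<in> A - {a}" _ "\<lambda>u. card (nbhd E u)" "Suc (card V)"]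
      card_mono[OF fin nbhd_subset[OF graph]] A by (metis DiffD1 le_imp_less_Suc subsetD ex_in_conv)
  have inN: "a \<in> nbhd E v" "b \<in> nbhd E v" and ne: "a \<noteq> b" "a \<noteq> v" "b \<noteq> v"
    and inV: "a \<in> V" "b \<in> V"
    using a b A by (auto simp: A_def)
  have below_b: "nbhd E u \<subseteq> nbhd E b" if "u \<in> nbhd E v" for u
  proof (cases "u = v")
    case True
    then show ?thesis using clique inN by simp
  next
    case False
    then have u: "u \<in> A" using that by (simp add: A_def)
    have "card (nbhd E u) \<le> card (nbhd E b)" using a b u by (cases "u = a") auto
    moreover have "finite (nbhd E u)" using finN A u by blast
    ultimately show ?thesis
      using v(2) that inN card_seteq[of "nbhd E u" "nbhd E b"]
      unfolding simple_vertex_def by blast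
  qed
  have e: "{a, b} \<in> E" using clique[OF inN(1)] inN(2) ne(1) nbhd_edge[of b E a] by blast
  have "\<not> tough t V (E - {{a, b}})"
  proof -
    have "simple_graph V (E - {{a, b}})" using graph by (auto simp: simple_graph_def)
    from tough_iff_le_toughness[OF this] show ?thesis
      using min e by (auto simp: minimally_tough_def not_le)
  qed
  then obtain S and f :: "'a \<Rightarrow> 'a set" where S: "S \<subseteq> V"
    and f: "\<And>x y. x \<in> V - S \<Longrightarrow> y \<in> V - S \<Longrightarrow> {x, y} \<in> E - {{a, b}} \<Longrightarrow> f x = f y"
    and M: "card (f ` (V - S)) > 1" "card S < t * card (f ` (V - S))"
    by (rule not_tough_labels) blast
  have finS: "finite S" using S fin finite_subset by blast
  \<comment> \<open>Otherwise \<open>f\<close> would respect the edge \<open>ab\<close> too, and the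
    toughness of the original graph would contradict the choice of \<open>S\<close>.\<close>
  have sep: "a \<notin> S \<and> b \<notin> S \<and> f a \<noteq> f b"
  proof (rule ccontr)
    assume *: "\<not> ?thesis"
    have "f x = f y" if "x \<in> V - S" "y \<in> V - S" "{x, y} \<in> E" for x y
      using f[OF that(1,2)] that * by (cases "{x, y} = {a, b}") (auto simp: doubleton_eq_iff)
    then have "t * card (f ` (V - S)) \<le> card S"
      using t by (intro tough_card_labels_le[OF tough fin _ S _ M(1)]) auto
    then show False using M by simp
  qed
  \<comment> \<open>Such an \<open>x\<close> is also adjacent to \<open>b\<close>, so outside
    \<open>S\<close> it would force equal labels on \<open>a\<close> and \<open>b\<close>.\<close>
  have common: "x \<in> S" if x: "x \<in> nbhd E a" "x \<noteq> a" "x \<noteq> b" for x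
  proof (rule ccontr)
    assume "x \<notin> S"
    have "x \<in> V" using x nbhd_subset[OF graph inV(1)] by auto
    moreover have "{a, x} \<in> E - {{a, b}}" "{x, b} \<in> E - {{a, b}}"
      using x nbhd_edge[of x E a] nbhd_edge[of x E b] below_b[OF inN(1)] ne
      by (auto simp: doubleton_eq_iff insert_commute)
    ultimately have "f a = f x" "f x = f b" using f sep inV \<open>x \<notin> S\<close> by auto
    then show False using sep by simp
  qed
  have "v \<in> S" using common[of v] nbhd_commute[of v E a] inN ne by auto
  show False
  proof (cases "nbhd E b \<subseteq> S \<union> {a, b}")
    case False
    \<comment> \<open>\<open>w\<close> keeps the label of \<open>b\<close> in use after
      \<open>b\<close> has moved into \<open>S'\<close>.\<close>
    then obtain w where w: "w \<in> nbhd E b" "w \<notin> S" "w \<noteq> a" "w \<noteq> b" by blast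
    have "w \<in> V" using w nbhd_subset[OF graph inV(2)] by auto
    have fw: "f w = f b"
      using f[of b w] w nbhd_edge[of w E b] inV sep \<open>w \<in> V\<close> by (auto simp: doubleton_eq_iff)
    define S' where "S' = insert b (S - {v})"
    \<comment> \<open>After the exchange no neighbour of \<open>v\<close> other than
      \<open>a\<close> is left, so \<open>v\<close> may take the label of \<open>a\<close>.\<close>
    define f' where "f' = f(v := f a)"
    have "b \<notin> S" using sep by simp
    then have "card S' = Suc (card (S - {v}))"
      unfolding S'_def using finS by (subst card_insert_disjoint) auto
    then have card_S': "card S' = card S"
      using card_Suc_Diff1[OF finS \<open>v \<in> S\<close>] by (rule trans)
    have vnbr: "y = a" if "y \<in> V - S'" "{v, y} \<in> E" for y
      using that edge_in_nbhd[OF that(2)] clique[OF inN(1)] common[of y]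
        simple_graph_edgeD[OF graph that(2)] by (auto simp: S'_def)
    have const: "f' x = f' y" if xy: "x \<in> V - S'" "y \<in> V - S'" "{x, y} \<in> E" for x y
    proof -
      consider "x = v" | "y = v" | "x \<noteq> v" "y \<noteq> v" by blast
      then show ?thesis
      proof cases
        case 1
        then show ?thesis using vnbr[of y] xy by (simp add: f'_def)
      next
        case 2
        then show ?thesis using vnbr[of x] xy by (simp add: f'_def insert_commute)
      next
        case 3
        then show ?thesis using f[of x y] xy
          by (auto simp: f'_def S'_def doubleton_eq_iff)
      qed
    qed
    have "f x \<in> f' ` (V - S')" if "x \<in> V - S" for x
    proof (cases "x = b")
      case True
      then have "f x = f' w" using fw w \<open>v \<in> S\<close> by (auto simp: f'_def)
      then show ?thesis using w \<open>w \<in> V\<close> by (auto simp: S'_def)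
    next
      case False
      then have "f x = f' x" "x \<in> V - S'" using that \<open>v \<in> S\<close> by (auto simp: f'_def S'_def)
      then show ?thesis by blast
    qed
    then have le: "card (f ` (V - S)) \<le> card (f' ` (V - S'))"
      using fin by (intro card_mono) auto
    have "t * card (f' ` (V - S')) \<le> card S'"
      using le M(1) t S inV const
      by (intro tough_card_labels_le[OF tough fin]) (auto simp: S'_def)
    moreover have "t * card (f ` (V - S)) \<le> t * card (f' ` (V - S'))"
      using le t by (intro mult_left_mono) auto
    ultimately show False using M(2) card_S' by simp
  next
    case True
    \<comment> \<open>\<open>B\<close> contains \<open>v\<close> itself, so it has
      \<open>deg v - 1\<close> elements although two neighbours are omitted.\<close>
    define B where "B = nbhd E v - {a, b}"
    define S' where "S' = S - B"
    have BS: "B \<subseteq> S" using clique[OF inN(1)] common by (auto simp: B_def)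
    have "A - {a, b} \<subseteq> B" "B = insert v (A - {a, b})"
      using ne nbhd_self[of v E] by (auto simp: A_def B_def)
    moreover have "card (A - {a, b}) = card A - 2"
      using a(1) b(1) A ne by (simp add: card_Diff_subset)
    ultimately have card_B: "card B = card A - 1"
      using A card_A by simp
    have card_S': "card S' = card S - card B" "card B \<le> card S"
      unfolding S'_def using BS finS finite_subset[OF BS finS]
      by (auto simp: card_Diff_subset intro: card_mono)
    \<comment> \<open>Every \<open>nbhd E x\<close> here lies in \<open>nbhd E b\<close>, hence in
      \<open>S\<close> together with \<open>a\<close> and \<open>b\<close>. So after
      \<open>B\<close> is put back, no edge leaves \<open>nbhd E v\<close> outside
      \<open>S'\<close>.\<close>
    have closed: "y \<in> nbhd E v" if "x \<in> nbhd E v" "y \<in> V - S'" "{x, y} \<in> E" for x y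
      using that edge_in_nbhd[OF that(3)] below_b[OF that(1)] True inN by (auto simp: S'_def B_def)
    show False
    \<comment> \<open>With two labels, merging could leave only one, about which toughness says
      nothing. Instead, \<open>z\<close> outside \<open>S\<close> is separated from
      \<open>nbhd E v\<close> by \<open>S'\<close>, and \<open>z\<close> inside \<open>S\<close>
      forces \<open>S\<close> to have at least \<open>deg v >= 2 * t\<close> elements.\<close>
    proof (cases "card (f ` (V - S)) = 2")
      case True
      have "z \<in> S"
      proof (rule ccontr)
        assume "z \<notin> S"
        then have two: "(\<lambda>x. x \<in> nbhd E v) ` (V - S') = {True, False}"
          using z inN inV sep by (force simp: S'_def)
        have same: "(x \<in> nbhd E v) = (y \<in> nbhd E v)"
          if "x \<in> V - S'" "y \<in> V - S'" "{x, y} \<in> E" for x y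
          using closed[of x y] closed[of y x] that by (auto simp: insert_commute)
        have "S' \<subseteq> V" using S by (auto simp: S'_def)
        then have "t * card ((\<lambda>x. x \<in> nbhd E v) ` (V - S')) \<le> card S'"
          by (intro tough_card_labels_le[OF tough fin _ _ same]) (use t two in simp_all)
        then have "2 * t \<le> card S'" unfolding two by simp
        then show False using M(2) True card_S' by simp
      qed
      then have "card (insert z B) \<le> card S"
        using BS finS by (intro card_mono) auto
      moreover have "z \<notin> B" using z by (simp add: B_def)
      ultimately have "card A \<le> card S"
        using card_B card_A finite_subset[OF BS finS] by simp
      then show False using M(2) True degree by simp
    next
      case False
      \<comment> \<open>This merges the labels of \<open>a\<close> and \<open>b\<close> over all of
        \<open>nbhd E v\<close>. Only \<open>f b\<close> can disappear, so at least two labels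
        remain.\<close>
      define f' where "f' x = (if x \<in> nbhd E v then f a else f x)" for x
      have const: "f' x = f' y" if xy: "x \<in> V - S'" "y \<in> V - S'" "{x, y} \<in> E" for x y
      proof (cases "x \<in> nbhd E v \<or> y \<in> nbhd E v")
        case True
        then show ?thesis
          using closed[of x y] closed[of y x] xy by (auto simp: f'_def insert_commute)
      next
        case False
        then show ?thesis using f[of x y] xy inN
          by (auto simp: f'_def S'_def B_def doubleton_eq_iff)
      qed
      have "f x \<in> f' ` (V - S')" if "x \<in> V - S" "f x \<noteq> f b" for x
      proof -
        have "f x = f' x" using that BS by (auto simp: f'_def B_def)
        then show ?thesis using that by (auto simp: S'_def)
      qed
      then have "card (f ` (V - S) - {f b}) \<le> card (f' ` (V - S'))"
        using fin by (intro card_mono) auto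
      then have le: "card (f ` (V - S)) - 1 \<le> card (f' ` (V - S'))"
        using sep inV by simp
      have "t * card (f' ` (V - S')) \<le> card S'"
        using le M(1) False t S const
        by (intro tough_card_labels_le[OF tough fin]) (auto simp: S'_def)
      moreover have "t * (real (card (f ` (V - S))) - 1) \<le> t * card (f' ` (V - S'))"
        using le t M(1) by (intro mult_left_mono) auto
      moreover have "real (card S') = real (card S) - (real (card A) - 1)"
        using card_S' card_B card_A by linarith
      \<comment> \<open>As \<open>deg v\<close> is at least 2,
        \<open>t <= deg v / 2 <= deg v - 1\<close>: the saving in vertices pays for the lost
        label.\<close>
      moreover have "t \<le> real (card A) - 1" using degree card_A by linarith
      ultimately show False using M by (simp add: algebra_simps)
    qed
  qed
qed

theorem theorem4p2:
  fixes t :: rat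
  assumes "t > 1 / 2"
  shows "\<not> (\<exists>(V :: 'a set) E. simple_graph V E \<and> strongly_chordal V E \<and>
              minimally_tough (of_rat t) V E)"
proof
  assume "\<exists>(V :: 'a set) E. simple_graph V E \<and> strongly_chordal V E \<and>
    minimally_tough (of_rat t) V E"
  then obtain V :: "'a set" and E where graph: "simple_graph V E"
    and sc: "strongly_chordal V E" and min: "minimally_tough (of_rat t) V E" by blast
  have "real_of_rat (1 / 2) < real_of_rat t"
    using assms by (simp only: of_rat_less)
  then have t: "real_of_rat t > 1 / 2" by (simp add: of_rat_divide)
  \<comment> \<open>The empty graph counts as complete and so has infinite toughness.\<close>
  have "V \<noteq> {}"
  proof
    assume "V = {}"
    then have "complete_graph V E" using graph by (auto simp: complete_graph_def simple_graph_def)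
    then show False using min by (simp add: minimally_tough_def toughness_def)
  qed
  then obtain v where "v \<in> V" "simple_vertex E v"
    using strongly_chordal_simple_vertex[OF graph sc] by blast
  then show False using simple_vertex_not_minimally_tough[OF graph t] min by blast
qed

end
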